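(* Let $\mathcal{U}=(U_\alpha)_{\alpha>0}$ be a sub-Markovian resolvent of kernels on a Lusin measurable space $(E,\mathcal{B})$ and let $m$ be a $\mathcal{U}$-sub-invariant probability measure. Let $\mathcal{I}$ be the set of all $\mathcal{U}$-invariant probability measures on $(E,\mathcal{B})$, and let $\mathcal{G}^m$ be the set of all probability measures on $(E,\mathcal{B})$ of the form $u\cdot m$ with $u$ a $\mathcal{U}$-invariant function (with respect to $m$). Consider the following assertions. (i) $\mathcal{U}$ is $m$-irreducible. (ii) $\mathcal{G}^m=\{m\}$. (iii) The measure $m$ is extremal in $\mathcal{G}^m$. (iv) The measure $m$ is extremal in $\mathcal{I}$. Then (i) $\Rightarrow$ (ii) $\Leftrightarrow$ (iii). If $\mathcal{U}$ is $m$-symmetric then assertions (i)–(iii) are equivalent. If $\mathcal{U}$ is $m$-recurrent then assertions (i)–(iv) are equivalent.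
   Context: A sub-Markovian resolvent of kernels satisfies the resolvent equation and $\alpha U_\alpha1\le1$; $p\mathcal{B}$ (resp. $bp\mathcal{B}$) denotes the positive (resp. bounded positive) $\mathcal{B}$-measurable functions. A measure $\mu$ is sub-invariant if $\mu\circ\alpha U_\alpha\le\mu$ for all $\alpha>0$, and a probability measure $\mu$ is $\mathcal{U}$-invariant if $\mu\circ\alpha U_\alpha=\mu$ for all $\alpha>0$. The initial kernel is $U:=\sup_{\alpha}U_\alpha=\sup_n U_{1/n}$. A real-valued function $v\in\bigcup_{1\le p\le\infty}L^p(E,m)$ is $\mathcal{U}$-invariant (with respect to $m$) if $U_\alpha(vf)=v\,U_\alpha f$ $m$-a.e. for all $\alpha>0$ and $f\in bp\mathcal{B}$. $A\in\mathcal{B}$ is $\mathcal{U}$-absorbing (with respect to $m$) if $U(1_{E\setminus A})=0$ $m$-a.e. on $A$; $\mathcal{U}$ is $m$-irreducible if every $\mathcal{U}$-absorbing $A$ satisfies $m(A)=0$ or $m(E\setminus A)=0$. $\mathcal{U}$ is $m$-recurrent if for every $f\in p\mathcal{B}\cap L^1(E,m)$ we have $m(\{x\in E:0<Uf(x)<\infty\})=0$. $\mathcal{U}$ is $m$-symmetric if $\int fU_\alpha g\,dm=\int gU_\alpha f\,dm$ for all $f,g\in p\mathcal{B}$, $\alpha>0$. $m$ is extremal in a convex set $\mathcal{C}$ of probability measures if $m\in\mathcal{C}$ and $m=tm_1+(1-t)m_2$ with $m_1,m_2\in\mathcal{C}$, $t\in(0,1)$ implies $m_1=m_2=m$.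
   Formalization: In the recurrent case, (iii) ⇒ (iv) is stated under the extra assumption that U1 is not 0 m-a.e.; without it the claim fails, e.g. for E a single point, U_α = 0 and m the Dirac measure, where (i)–(iii) hold but m is not invariant. *)

theory Defs
  imports "HOL-Analysis.Analysis" "HOL-Probability.Probability_Measure"
begin

text \<open>
  A measurable space \<open>(E, \<B>)\<close> is represented by a measure \<open>E\<close> of which only \<open>space E\<close> and
  \<open>sets E\<close> are used.  A family of kernels is a map \<open>U :: real \<Rightarrow> 'a \<Rightarrow> 'a measure\<close>; only the
  values \<open>U \<alpha> x\<close> with \<open>\<alpha> > 0\<close> and \<open>x \<in> space E\<close> matter.
\<close>

text \<open>
  Lusin measurable space: measurably isomorphic to a Borel subset \<open>S\<close> of a compact metrizable
  space \<open>K\<close> with its Borel sigma-algebra.  The points of \<open>K\<close> are taken from the type \<open>real\<close>; this is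
  no restriction, as a compact metrizable space has at most continuum many points.
  The topology of \<open>K\<close> is arbitrary.
\<close>

definition lusin_measurable_space :: "'a measure \<Rightarrow> bool" where
  "lusin_measurable_space E \<longleftrightarrow>
     (\<exists>(K :: real topology) S f g.
        compact_space K \<and> metrizable_space K \<and>
        S \<in> sigma_sets (topspace K) {V. openin K V} \<and>
        f \<in> measurable E (restrict_space (sigma (topspace K) {V. openin K V}) S) \<and>
        g \<in> measurable (restrict_space (sigma (topspace K) {V. openin K V}) S) E \<and>
        (\<forall>x\<in>space E. g (f x) = x) \<and> (\<forall>y\<in>S. f (g y) = y))"

definition kernel :: "'a measure \<Rightarrow> ('a \<Rightarrow> 'a measure) \<Rightarrow> bool" where
  "kernel E K \<longleftrightarrow>
     (\<forall>x\<in>space E. sets (K x) = sets E) \<and>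
     (\<forall>A\<in>sets E. (\<lambda>x. emeasure (K x) A) \<in> borel_measurable E)"

text \<open>
  The resolvent equation \<open>U\<^sub>\<alpha> = U\<^sub>\<beta> + (\<beta> - \<alpha>) U\<^sub>\<alpha> U\<^sub>\<beta>\<close> can be written with real values, since
  \<open>\<alpha> U\<^sub>\<alpha> 1 \<le> 1\<close> makes all kernels involved bounded.
\<close>

definition sub_markovian_resolvent :: "'a measure \<Rightarrow> (real \<Rightarrow> 'a \<Rightarrow> 'a measure) \<Rightarrow> bool" where
  "sub_markovian_resolvent E U \<longleftrightarrow>
     (\<forall>\<alpha>>0. kernel E (U \<alpha>)) \<and>
     (\<forall>\<alpha>>0. \<forall>x\<in>space E. ennreal \<alpha> * emeasure (U \<alpha> x) (space E) \<le> 1) \<and>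
     (\<forall>\<alpha>>0. \<forall>\<beta>>0. \<forall>x\<in>space E. \<forall>A\<in>sets E.
        measure (U \<alpha> x) A =
          measure (U \<beta> x) A + (\<beta> - \<alpha>) * (\<integral>y. measure (U \<beta> y) A \<partial>U \<alpha> x))"

definition initial_kernel :: "(real \<Rightarrow> 'a \<Rightarrow> 'a measure) \<Rightarrow> ('a \<Rightarrow> ennreal) \<Rightarrow> 'a \<Rightarrow> ennreal" where
  "initial_kernel U f x = (SUP \<alpha>\<in>{0<..}. \<integral>\<^sup>+y. f y \<partial>U \<alpha> x)"

definition sub_invariant_measure ::
    "'a measure \<Rightarrow> (real \<Rightarrow> 'a \<Rightarrow> 'a measure) \<Rightarrow> 'a measure \<Rightarrow> bool" where
  "sub_invariant_measure E U \<mu> \<longleftrightarrow>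
     sets \<mu> = sets E \<and>
     (\<forall>\<alpha>>0. \<forall>A\<in>sets E. (\<integral>\<^sup>+x. ennreal \<alpha> * emeasure (U \<alpha> x) A \<partial>\<mu>) \<le> emeasure \<mu> A)"

definition invariant_prob_measures ::
    "'a measure \<Rightarrow> (real \<Rightarrow> 'a \<Rightarrow> 'a measure) \<Rightarrow> 'a measure set" where
  "invariant_prob_measures E U =
     {\<mu>. sets \<mu> = sets E \<and> prob_space \<mu> \<and>
         (\<forall>\<alpha>>0. \<forall>A\<in>sets E. (\<integral>\<^sup>+x. ennreal \<alpha> * emeasure (U \<alpha> x) A \<partial>\<mu>) = emeasure \<mu> A)}"

definition Lp_functions :: "ennreal \<Rightarrow> 'a measure \<Rightarrow> ('a \<Rightarrow> real) set" where
  "Lp_functions p m =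
     {v \<in> borel_measurable m.
        if p = \<infinity> then (\<exists>C. AE x in m. \<bar>v x\<bar> \<le> C)
        else integrable m (\<lambda>x. \<bar>v x\<bar> powr enn2real p)}"

text \<open>
  If \<open>m\<close> is a sub-invariant probability measure and \<open>v\<close> is in some \<open>L\<^sup>p\<close>, then \<open>v * f\<close> is
  \<open>U \<alpha> x\<close>-integrable for \<open>m\<close>-almost every \<open>x\<close>, so that the value 0 of the Bochner integral of a
  non-integrable function is irrelevant here.
\<close>

definition invariant_function ::
    "(real \<Rightarrow> 'a \<Rightarrow> 'a measure) \<Rightarrow> 'a measure \<Rightarrow> ('a \<Rightarrow> real) \<Rightarrow> bool" where
  "invariant_function U m v \<longleftrightarrow>
     v \<in> (\<Union>p\<in>{1..}. Lp_functions p m) \<and>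
     (\<forall>\<alpha>>0. \<forall>f\<in>borel_measurable m.
        (\<forall>x\<in>space m. 0 \<le> f x) \<longrightarrow> (\<exists>C. \<forall>x\<in>space m. f x \<le> C) \<longrightarrow>
        (AE x in m. (\<integral>y. v y * f y \<partial>U \<alpha> x) = v x * (\<integral>y. f y \<partial>U \<alpha> x)))"

text \<open>
  \<open>\<G>\<^sup>m\<close>: a signed measure \<open>u \<cdot> m\<close> that is a (positive) measure has \<open>u \<ge> 0\<close> \<open>m\<close>-a.e.  This has to be
  stated, because \<open>ennreal\<close> cuts off negative values.
\<close>

definition invariant_density_measures ::
    "(real \<Rightarrow> 'a \<Rightarrow> 'a measure) \<Rightarrow> 'a measure \<Rightarrow> 'a measure set" where
  "invariant_density_measures U m =
     {density m (\<lambda>x. ennreal (u x)) | u.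
        invariant_function U m u \<and> (AE x in m. 0 \<le> u x) \<and>
        prob_space (density m (\<lambda>x. ennreal (u x)))}"

definition extremal_in :: "'a measure \<Rightarrow> 'a measure set \<Rightarrow> bool" where
  "extremal_in m C \<longleftrightarrow>
     m \<in> C \<and>
     (\<forall>m1\<in>C. \<forall>m2\<in>C. \<forall>t::real. 0 < t \<and> t < 1 \<and>
        (\<forall>A\<in>sets m. measure m A = t * measure m1 A + (1 - t) * measure m2 A) \<longrightarrow>
        m1 = m \<and> m2 = m)"

definition absorbing :: "(real \<Rightarrow> 'a \<Rightarrow> 'a measure) \<Rightarrow> 'a measure \<Rightarrow> 'a set \<Rightarrow> bool" where
  "absorbing U m A \<longleftrightarrow>
     A \<in> sets m \<and>
     (AE x in m. x \<in> A \<longrightarrow> initial_kernel U (indicator (space m - A)) x = 0)"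

definition irreducible_resolvent :: "(real \<Rightarrow> 'a \<Rightarrow> 'a measure) \<Rightarrow> 'a measure \<Rightarrow> bool" where
  "irreducible_resolvent U m \<longleftrightarrow>
     (\<forall>A. absorbing U m A \<longrightarrow> emeasure m A = 0 \<or> emeasure m (space m - A) = 0)"

definition recurrent_resolvent :: "(real \<Rightarrow> 'a \<Rightarrow> 'a measure) \<Rightarrow> 'a measure \<Rightarrow> bool" where
  "recurrent_resolvent U m \<longleftrightarrow>
     (\<forall>f\<in>borel_measurable m. (\<integral>\<^sup>+x. f x \<partial>m) < \<infinity> \<longrightarrow>
        emeasure m {x \<in> space m. 0 < initial_kernel U f x \<and> initial_kernel U f x < \<infinity>} = 0)"

definition symmetric_resolvent :: "(real \<Rightarrow> 'a \<Rightarrow> 'a measure) \<Rightarrow> 'a measure \<Rightarrow> bool" where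
  "symmetric_resolvent U m \<longleftrightarrow>
     (\<forall>\<alpha>>0. \<forall>f\<in>borel_measurable m. \<forall>g\<in>borel_measurable m.
        (\<integral>\<^sup>+x. f x * (\<integral>\<^sup>+y. g y \<partial>U \<alpha> x) \<partial>m) = (\<integral>\<^sup>+x. g x * (\<integral>\<^sup>+y. f y \<partial>U \<alpha> x) \<partial>m))"

text \<open>
  If \<open>U = 0\<close> \<open>m\<close>-a.e., then the resolvent is vacuously recurrent, yet \<open>m\<close> is not invariant; if moreover
  \<open>m\<close> is a Dirac measure, the resolvent is irreducible.  Extremality of \<open>m\<close> among the
  invariant probability measures can therefore follow from irreducibility and recurrence only if
  this case is excluded.
\<close>

definition nonzero_resolvent :: "(real \<Rightarrow> 'a \<Rightarrow> 'a measure) \<Rightarrow> 'a measure \<Rightarrow> bool" where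
  "nonzero_resolvent U m \<longleftrightarrow> \<not> (AE x in m. initial_kernel U (\<lambda>_. 1) x = 0)"

end

theory Submission
  imports Defs
begin

text \<open>
  Call a set invariant if it and its complement are absorbing.  The set \<open>{u > 1}\<close> is invariant for every
  invariant function \<open>u\<close>, and a probability density \<open>u\<close> for which \<open>{u > 1}\<close> is null or conull is 1
  almost everywhere; conversely, \<open>m\<close> conditioned on a nontrivial invariant set is in \<open>\<G>\<^sup>m\<close>, and in \<open>\<I>\<close>
  if \<open>m\<close> is.  So (ii) and (iii) both say that invariant sets are trivial, and (iv) implies this.
  Symmetry or recurrence makes the complement of an absorbing set absorbing, which gives (i).
\<close>

text \<open>Exceptional \<open>m\<close>-null sets depend on \<alpha>, while the initial kernel is a
  supremum over uncountably many \<alpha>. Monotonicity in \<alpha> reduces it to a sequence, so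
  that absorption can be handled for one \<alpha> at a time. The implication to (iv) is not a
  comparison of the two convex sets: the density of an invariant measure with respect to
  \<open>m\<close> is not known beforehand to be an invariant function. Irreducibility is instead
  applied directly to a level set of such a density. Moreover \<open>m\<close> itself must first be
  shown invariant, although only sub-invariance is given. The obstacle is loss of mass,
  \<open>\<alpha> U\<^sub>\<alpha> 1 < 1\<close>. Recurrence makes the set where it happens
  invisible to the kernels, but this set can still carry all of \<open>m\<close> when
  \<open>U = 0\<close>; irreducibility together with \<open>nonzero_resolvent\<close> excludes
  that.\<close>

locale sub_invariant_resolvent = prob_space m
  for m :: "'a measure" +
  fixes E :: "'a measure" and U :: "real \<Rightarrow> 'a \<Rightarrow> 'a measure"
  assumes resolvent: "sub_markovian_resolvent E U"
    and sub_invariant: "sub_invariant_measure E U m"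
begin

section \<open>Elementary facts on the kernels and sub-invariance\<close>

lemma sets_m: "sets m = sets E"
  using sub_invariant by (simp add: sub_invariant_measure_def)

lemma space_m: "space m = space E"
  using sets_m by (rule sets_eq_imp_space_eq)

lemma sets_U: "\<alpha> > 0 \<Longrightarrow> x \<in> space m \<Longrightarrow> sets (U \<alpha> x) = sets m"
  using resolvent by (simp add: sub_markovian_resolvent_def kernel_def sets_m space_m)

lemma space_U: "\<alpha> > 0 \<Longrightarrow> x \<in> space m \<Longrightarrow> space (U \<alpha> x) = space m"
  using sets_U by (rule sets_eq_imp_space_eq)

lemma emeasure_U_space_le:
  "\<alpha> > 0 \<Longrightarrow> x \<in> space m \<Longrightarrow> ennreal \<alpha> * emeasure (U \<alpha> x) (space m) \<le> 1"
  using resolvent by (simp add: sub_markovian_resolvent_def space_m)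

lemma finite_measure_U: assumes "\<alpha> > 0" "x \<in> space m" shows "finite_measure (U \<alpha> x)"
proof
  show "emeasure (U \<alpha> x) (space (U \<alpha> x)) \<noteq> \<infinity>"
    using emeasure_U_space_le[OF assms] assms(1)
    by (auto simp: space_U[OF assms] ennreal_mult_top top_unique)
qed

lemma emeasure_U: "\<alpha> > 0 \<Longrightarrow> x \<in> space m \<Longrightarrow> emeasure (U \<alpha> x) A = ennreal (measure (U \<alpha> x) A)"
  by (intro finite_measure.emeasure_eq_measure finite_measure_U)

lemma measurable_U: "\<alpha> > 0 \<Longrightarrow> x \<in> space m \<Longrightarrow> f \<in> borel_measurable m \<Longrightarrow> f \<in> borel_measurable (U \<alpha> x)"
  using measurable_cong_sets[OF sets_U refl] by blast

lemma measure_U_le: assumes "\<alpha> > 0" "x \<in> space m" shows "\<alpha> * measure (U \<alpha> x) A \<le> 1"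
proof -
  have "ennreal (\<alpha> * measure (U \<alpha> x) (space m)) \<le> ennreal 1"
    using emeasure_U_space_le[OF assms] assms by (simp add: emeasure_U ennreal_mult)
  moreover have "measure (U \<alpha> x) A \<le> measure (U \<alpha> x) (space m)"
    using finite_measure.bounded_measure[OF finite_measure_U[OF assms]] by (simp add: space_U[OF assms])
  then have "\<alpha> * measure (U \<alpha> x) A \<le> \<alpha> * measure (U \<alpha> x) (space m)"
    using assms(1) by (intro mult_left_mono) auto
  ultimately show ?thesis by simp
qed

lemma borel_measurable_measure_U [measurable]:
  assumes "\<alpha> > 0" "A \<in> sets m" shows "(\<lambda>x. measure (U \<alpha> x) A) \<in> borel_measurable m"
proof -
  have "(\<lambda>x. emeasure (U \<alpha> x) A) \<in> borel_measurable E"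
    using resolvent assms by (simp add: sub_markovian_resolvent_def kernel_def sets_m)
  then have "(\<lambda>x. emeasure (U \<alpha> x) A) \<in> borel_measurable m"
    using measurable_cong_sets[OF sets_m refl] by blast
  then show ?thesis
    unfolding measure_def by simp
qed

lemma borel_measurable_emeasure_U [measurable]:
  assumes "\<alpha> > 0" "A \<in> sets m" shows "(\<lambda>x. emeasure (U \<alpha> x) A) \<in> borel_measurable m"
  using borel_measurable_measure_U[OF assms]
  by (subst measurable_cong[where g="\<lambda>x. ennreal (measure (U \<alpha> x) A)"]) (auto simp: emeasure_U assms)

lemma resolvent_equation:
  assumes "\<alpha> > 0" "\<beta> > 0" "x \<in> space m" "A \<in> sets m"
  shows "measure (U \<alpha> x) A = measure (U \<beta> x) A + (\<beta> - \<alpha>) * (\<integral>y. measure (U \<beta> y) A \<partial>U \<alpha> x)"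
  using resolvent assms unfolding sub_markovian_resolvent_def space_m sets_m by blast

text \<open>The correction term of the resolvent equation has the sign of \<beta> -
  \<alpha>.\<close>

lemma measure_U_antimono:
  assumes "0 < \<alpha>" "\<alpha> \<le> \<beta>" "x \<in> space m" "A \<in> sets m"
  shows "measure (U \<beta> x) A \<le> measure (U \<alpha> x) A"
  using resolvent_equation[of \<alpha> \<beta> x A] assms by (simp add: integral_nonneg_AE)

lemma integrable_measure_U: "\<alpha> > 0 \<Longrightarrow> A \<in> sets m \<Longrightarrow> integrable m (\<lambda>x. measure (U \<alpha> x) A)"
  by (rule integrable_const_bound[where B="1/\<alpha>"])
    (auto simp: field_simps measure_U_le)

lemma sub_invariant_integral_le:
  assumes "\<alpha> > 0" "A \<in> sets m"
  shows "(\<integral>x. \<alpha> * measure (U \<alpha> x) A \<partial>m) \<le> measure m A"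
proof -
  have "ennreal (\<integral>x. \<alpha> * measure (U \<alpha> x) A \<partial>m) = (\<integral>\<^sup>+x. ennreal (\<alpha> * measure (U \<alpha> x) A) \<partial>m)"
    using assms by (intro nn_integral_eq_integral[symmetric]) (auto simp: integrable_measure_U)
  also have "\<dots> = (\<integral>\<^sup>+x. ennreal \<alpha> * emeasure (U \<alpha> x) A \<partial>m)"
    using assms by (intro nn_integral_cong) (auto simp: emeasure_U ennreal_mult)
  also have "\<dots> \<le> ennreal (measure m A)"
    using sub_invariant assms by (simp add: sub_invariant_measure_def sets_m emeasure_eq_measure)
  finally show ?thesis by simp
qed

lemma AE_U_null:
  assumes "\<alpha> > 0" "A \<in> sets m" "measure m A = 0"
  shows "AE x in m. measure (U \<alpha> x) A = 0"
proof -
  have "(\<integral>x. \<alpha> * measure (U \<alpha> x) A \<partial>m) = 0"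
    using sub_invariant_integral_le[OF assms(1,2)] assms by (intro antisym) (auto simp: integral_nonneg_AE)
  then have "AE x in m. \<alpha> * measure (U \<alpha> x) A = 0"
    using assms by (subst (asm) integral_nonneg_eq_0_iff_AE) (auto simp: integrable_measure_U)
  then show ?thesis using assms by auto
qed

section \<open>Absorbing and invariant sets\<close>

text \<open>By \<open>measure_U_antimono\<close> the values increase as \<alpha> decreases, so a
  sequence of parameters tending to 0 decides whether the supremum vanishes.\<close>

lemma initial_kernel_indicator_eq_0_iff:
  assumes "x \<in> space m" "A \<in> sets m"
  shows "initial_kernel U (indicator A) x = 0 \<longleftrightarrow> (\<forall>n. measure (U (1 / real (Suc n)) x) A = 0)"
proof -
  have "initial_kernel U (indicator A) x = (SUP \<alpha>\<in>{0<..}. ennreal (measure (U \<alpha> x) A))"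
    unfolding initial_kernel_def using assms by (intro SUP_cong) (auto simp: sets_U emeasure_U)
  then have "initial_kernel U (indicator A) x = 0 \<longleftrightarrow> (\<forall>\<alpha>>0. measure (U \<alpha> x) A = 0)"
    by (auto simp: SUP_eq_iff bot_ennreal[symmetric] SUP_bot_conv) (simp_all add: bot_ennreal measure_le_0_iff)
  also have "\<dots> \<longleftrightarrow> (\<forall>n. measure (U (1 / real (Suc n)) x) A = 0)"
  proof (intro iffI allI impI)
    fix \<alpha> :: real assume *: "\<forall>n. measure (U (1 / real (Suc n)) x) A = 0" and "\<alpha> > 0"
    obtain n where "1 / real (Suc n) < \<alpha>"
      using reals_Archimedean[OF \<open>\<alpha> > 0\<close>] by (auto simp: inverse_eq_divide)
    then have "measure (U \<alpha> x) A \<le> 0"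
      using measure_U_antimono[of "1 / real (Suc n)" \<alpha> x A] * assms by simp
    then show "measure (U \<alpha> x) A = 0" by (simp add: measure_le_0_iff)
  qed simp
  finally show ?thesis .
qed

text \<open>On the right the null set may vary with \<alpha>; only countably many of these null sets
  have to be united because the sequence \<open>1 / Suc n\<close> suffices. The predicate
  \<open>P\<close> is membership in a set for absorption, and \<open>True\<close> when the potential
  is to vanish almost everywhere.\<close>

lemma AE_initial_kernel_indicator_eq_0_iff:
  assumes "A \<in> sets m"
  shows "(AE x in m. P x \<longrightarrow> initial_kernel U (indicator A) x = 0) \<longleftrightarrow>
    (\<forall>\<alpha>>0. AE x in m. P x \<longrightarrow> measure (U \<alpha> x) A = 0)" (is "?L \<longleftrightarrow> ?R")
proof
  assume ?L
  show ?R
  proof (intro allI impI)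
    fix \<alpha> :: real assume "\<alpha> > 0"
    then obtain n where n: "1 / real (Suc n) < \<alpha>"
      using reals_Archimedean by (auto simp: inverse_eq_divide)
    show "AE x in m. P x \<longrightarrow> measure (U \<alpha> x) A = 0"
      using \<open>?L\<close> AE_space
    proof eventually_elim
      case (elim x)
      then show ?case
        using measure_U_antimono[of "1 / real (Suc n)" \<alpha> x A] n assms
        by (auto simp: initial_kernel_indicator_eq_0_iff intro: antisym)
    qed
  qed
next
  assume ?R
  then have "AE x in m. \<forall>n. P x \<longrightarrow> measure (U (1 / real (Suc n)) x) A = 0"
    by (intro iffD2[OF AE_all_countable]) simp
  then show ?L
    using AE_space by eventually_elim (use assms in \<open>auto simp: initial_kernel_indicator_eq_0_iff\<close>)
qed

lemma absorbing_iff: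
  "absorbing U m A \<longleftrightarrow> A \<in> sets m \<and>
    (\<forall>\<alpha>>0. AE x in m. x \<in> A \<longrightarrow> measure (U \<alpha> x) (space m - A) = 0)"
  unfolding absorbing_def
  by (intro conj_cong refl AE_initial_kernel_indicator_eq_0_iff) simp

definition invariant_set :: "'a set \<Rightarrow> bool" where
  "invariant_set A \<longleftrightarrow> absorbing U m A \<and> absorbing U m (space m - A)"

lemma invariant_set_iff:
  "invariant_set A \<longleftrightarrow> A \<in> sets m \<and>
    (\<forall>\<alpha>>0. AE x in m. x \<in> A \<longrightarrow> measure (U \<alpha> x) (space m - A) = 0) \<and>
    (\<forall>\<alpha>>0. AE x in m. x \<notin> A \<longrightarrow> measure (U \<alpha> x) A = 0)"
proof -
  have *: "(AE x in m. x \<in> space m - A \<longrightarrow> P x) \<longleftrightarrow> (AE x in m. x \<notin> A \<longrightarrow> P x)" for P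
    by (intro AE_cong) auto
  show ?thesis
    unfolding invariant_set_def absorbing_iff *
    by (auto dest: sets.sets_into_space simp: double_diff)
qed

lemma invariant_set_sets: "invariant_set A \<Longrightarrow> A \<in> sets m"
  by (simp add: invariant_set_iff)

lemma invariant_set_Compl: "invariant_set A \<Longrightarrow> invariant_set (space m - A)"
  using double_diff[OF sets.sets_into_space, of A m "space m"]
  by (simp add: invariant_set_def absorbing_iff)

section \<open>Invariant functions and their level sets\<close>

lemma borel_measurable_invariant_function: "invariant_function U m v \<Longrightarrow> v \<in> borel_measurable m"
  unfolding invariant_function_def Lp_functions_def by blast

text \<open>Test invariance with the indicator of a set \<open>R\<close> on which
  \<open>v - c\<close> has constant sign. The integral of \<open>v - c\<close> over \<open>R\<close>
  equals \<open>v x - c\<close> times the mass of \<open>R\<close>; if \<open>x\<close> lies on the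
  other side of the level \<open>c\<close>, the two sides have opposite signs and both
  vanish.\<close>

lemma invariant_function_level_set:
  assumes v: "invariant_function U m v"
  shows "invariant_set {x \<in> space m. v x > c}"
proof -
  have [measurable]: "v \<in> borel_measurable m"
    using v by (rule borel_measurable_invariant_function)
  define S where "S = {x \<in> space m. v x > c}"
  define T where "T = {x \<in> space m. v x \<le> c}"
  \<comment> \<open>An unbounded \<open>v\<close> need not be integrable under each
    \<open>U \<alpha> x\<close>, and a Bochner integral then defaults to 0. Cutting the test set
    down to \<open>B k\<close> keeps the integrals genuine, so that the constant \<open>c\<close>
    can be subtracted.\<close>
  define B where "B k = {x \<in> space m. \<bar>v x\<bar> \<le> real k}" for k
  have [measurable]: "S \<in> sets m" "T \<in> sets m" "B k \<in> sets m" for k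
    by (simp_all add: S_def T_def B_def)
  have key: "AE x in m. (\<integral>y. (v y - c) * indicator R y \<partial>U \<alpha> x) = (v x - c) * measure (U \<alpha> x) R"
    if "\<alpha> > 0" and [measurable]: "R \<in> sets m" and "R \<subseteq> B k" for \<alpha> R k
  proof -
    have "(\<forall>x\<in>space m. 0 \<le> (indicator R x :: real)) \<and> (\<exists>C. \<forall>x\<in>space m. indicator R x \<le> (C :: real))"
      by (auto intro!: exI[of _ 1] split: split_indicator)
    then have "AE x in m. (\<integral>y. v y * indicator R y \<partial>U \<alpha> x) = v x * (\<integral>y. indicator R y \<partial>U \<alpha> x)"
      using v \<open>\<alpha> > 0\<close> borel_measurable_indicator[OF \<open>R \<in> sets m\<close>] unfolding invariant_function_def by blast
    then show ?thesis
      using AE_space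
    proof eventually_elim
      case (elim x)
      interpret Ux: finite_measure "U \<alpha> x" by (rule finite_measure_U[OF \<open>\<alpha> > 0\<close> elim(2)])
      have [measurable]: "R \<in> sets (U \<alpha> x)" "v \<in> borel_measurable (U \<alpha> x)"
        using elim(2) \<open>\<alpha> > 0\<close> by (auto simp: sets_U intro: measurable_U)
      have "integrable (U \<alpha> x) (\<lambda>y. v y * indicator R y)"
        by (rule Ux.integrable_const_bound[where B="real k"])
          (use \<open>R \<subseteq> B k\<close> in \<open>auto simp: B_def split: split_indicator\<close>)
      then show ?case
        using elim by (simp add: left_diff_distrib Ux.integrable_const_bound[where B=1])
    qed
  qed
  \<comment> \<open>Since \<open>v\<close> is real-valued, the sets \<open>B k\<close> cover the
    space, and countably many null pieces make up \<open>R\<close>.\<close>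
  have exhaust: "AE x in m. P x \<longrightarrow> measure (U \<alpha> x) R = 0"
    if "\<alpha> > 0" and [measurable]: "R \<in> sets m"
      and *: "\<And>k. AE x in m. P x \<longrightarrow> measure (U \<alpha> x) (R \<inter> B k) = 0" for \<alpha> R P
  proof -
    have "AE x in m. \<forall>k. P x \<longrightarrow> measure (U \<alpha> x) (R \<inter> B k) = 0"
      using * by (intro iffD2[OF AE_all_countable]) simp
    then show ?thesis
      using AE_space
    proof eventually_elim
      case (elim x)
      show ?case
      proof
        assume "P x"
        have "(\<Union>k. R \<inter> B k) \<in> null_sets (U \<alpha> x)"
          using elim \<open>P x\<close> \<open>\<alpha> > 0\<close> by (intro null_sets_UN null_setsI) (auto simp: emeasure_U sets_U)
        moreover have "(\<Union>k. R \<inter> B k) = R"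
          using sets.sets_into_space[OF \<open>R \<in> sets m\<close>] real_arch_simple by (fastforce simp: B_def)
        ultimately show "measure (U \<alpha> x) R = 0"
          by (auto dest: null_setsD1 simp: measure_def)
      qed
    qed
  qed
  have leave: "AE x in m. x \<in> S \<longrightarrow> measure (U \<alpha> x) (T \<inter> B k) = 0" if "\<alpha> > 0" for \<alpha> k
    using key[OF that, of "T \<inter> B k" k, simplified]
  proof eventually_elim
    case (elim x)
    have "0 \<le> (\<integral>y. - ((v y - c) * indicator (T \<inter> B k) y) \<partial>U \<alpha> x)"
      by (rule integral_nonneg_AE) (auto simp: T_def split: split_indicator)
    then have "(\<integral>y. (v y - c) * indicator (T \<inter> B k) y \<partial>U \<alpha> x) \<le> 0"
      by simp
    then show ?case
      using elim by (auto simp: S_def zero_less_mult_iff mult_le_0_iff measure_le_0_iff)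
  qed
  \<comment> \<open>Not symmetric to \<open>leave\<close>: for \<open>v x = c\<close> the factor
    \<open>v x - c\<close> vanishes and gives no information on the mass. The strict positivity of
    \<open>v - c\<close> on \<open>S\<close> is used instead, through a nonnegative integrand with
    integral zero.\<close>
  have enter: "AE x in m. x \<notin> S \<longrightarrow> measure (U \<alpha> x) (S \<inter> B k) = 0" if "\<alpha> > 0" for \<alpha> k
    using key[OF that, of "S \<inter> B k" k, simplified] AE_space
  proof eventually_elim
    case (elim x)
    interpret Ux: finite_measure "U \<alpha> x" by (rule finite_measure_U[OF that elim(2)])
    have [measurable]: "S \<inter> B k \<in> sets (U \<alpha> x)" "v \<in> borel_measurable (U \<alpha> x)"
      using elim(2) that by (auto simp: sets_U intro: measurable_U)
    have int: "integrable (U \<alpha> x) (\<lambda>y. (v y - c) * indicator (S \<inter> B k) y)"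
    proof (rule Ux.integrable_const_bound[where B="real k + \<bar>c\<bar>"])
      show "AE y in U \<alpha> x. norm ((v y - c) * indicator (S \<inter> B k) y) \<le> real k + \<bar>c\<bar>"
        by (auto simp: B_def split: split_indicator)
    qed measurable
    have nonneg: "AE y in U \<alpha> x. 0 \<le> (v y - c) * indicator (S \<inter> B k) y"
      by (auto simp: S_def split: split_indicator)
    show ?case
    proof
      assume "x \<notin> S"
      then have "(v x - c) * measure (U \<alpha> x) (S \<inter> B k) \<le> 0"
        using elim(2) by (auto simp: S_def mult_le_0_iff)
      then have "(\<integral>y. (v y - c) * indicator (S \<inter> B k) y \<partial>U \<alpha> x) = 0"
        using elim(1) integral_nonneg_AE[OF nonneg] by simp
      then have "AE y in U \<alpha> x. (v y - c) * indicator (S \<inter> B k) y = 0"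
        using integral_nonneg_eq_0_iff_AE[OF int nonneg] by simp
      then have "AE y in U \<alpha> x. y \<notin> S \<inter> B k"
        by eventually_elim (auto simp: S_def)
      then show "measure (U \<alpha> x) (S \<inter> B k) = 0"
        by (subst (asm) AE_iff_measurable[OF \<open>S \<inter> B k \<in> sets (U \<alpha> x)\<close>])
          (use sets.sets_into_space[OF \<open>S \<inter> B k \<in> sets (U \<alpha> x)\<close>] in \<open>auto simp: measure_def\<close>)
    qed
  qed
  have "AE x in m. x \<in> S \<longrightarrow> measure (U \<alpha> x) T = 0" if "\<alpha> > 0" for \<alpha>
    by (rule exhaust[OF that \<open>T \<in> sets m\<close> leave[OF that]])
  moreover have "AE x in m. x \<notin> S \<longrightarrow> measure (U \<alpha> x) S = 0" if "\<alpha> > 0" for \<alpha>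
    by (rule exhaust[OF that \<open>S \<in> sets m\<close> enter[OF that]])
  moreover have "space m - S = T"
    by (auto simp: S_def T_def)
  ultimately show ?thesis
    unfolding S_def[symmetric] by (auto simp: invariant_set_iff)
qed

text \<open>For almost every \<open>x\<close> the measure \<open>U \<alpha> x\<close> lives on the
  same side of \<open>A\<close> as \<open>x\<close>, so under it the indicator of \<open>A\<close>
  is almost everywhere the constant \<open>indicator A x\<close>. The factor \<open>c\<close> will
  normalise densities.\<close>

lemma invariant_function_indicator:
  assumes A: "invariant_set A"
  shows "invariant_function U m (\<lambda>x. indicator A x * c)"
proof -
  have [measurable]: "A \<in> sets m" using A by (rule invariant_set_sets)
  have "(\<lambda>x. indicator A x * c) \<in> Lp_functions \<infinity> m"
    by (auto simp: Lp_functions_def split: split_indicator intro!: exI[of _ "\<bar>c\<bar>"])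
  moreover have "AE x in m. (\<integral>y. indicator A y * c * f y \<partial>U \<alpha> x) = indicator A x * c * (\<integral>y. f y \<partial>U \<alpha> x)"
    if "\<alpha> > 0" and [measurable]: "f \<in> borel_measurable m" for \<alpha> and f :: "'a \<Rightarrow> real"
  proof -
    have "AE x in m. (x \<in> A \<longrightarrow> measure (U \<alpha> x) (space m - A) = 0) \<and> (x \<notin> A \<longrightarrow> measure (U \<alpha> x) A = 0)"
      using A \<open>\<alpha> > 0\<close> by (auto simp: invariant_set_iff)
    then show ?thesis
      using AE_space
    proof eventually_elim
      case (elim x)
      have [measurable]: "A \<in> sets (U \<alpha> x)" "f \<in> borel_measurable (U \<alpha> x)"
        using elim(2) \<open>\<alpha> > 0\<close> by (auto simp: sets_U intro: measurable_U)
      have "AE y in U \<alpha> x. indicator A y = (indicator A x :: real)"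
      proof (cases "x \<in> A")
        case True
        then have "space m - A \<in> null_sets (U \<alpha> x)"
          using elim \<open>\<alpha> > 0\<close> by (auto simp: emeasure_U sets_U)
        then have "AE y in U \<alpha> x. y \<notin> space m - A"
          by (rule AE_not_in)
        then show ?thesis
          using AE_space
          by eventually_elim (use True elim \<open>\<alpha> > 0\<close> in \<open>auto simp: space_U\<close>)
      next
        case False
        then have "A \<in> null_sets (U \<alpha> x)"
          using elim \<open>\<alpha> > 0\<close> by (auto simp: emeasure_U sets_U)
        then show ?thesis
          by (rule AE_mp[OF AE_not_in]) (use False in auto)
      qed
      then have "(\<integral>y. indicator A y * c * f y \<partial>U \<alpha> x) = (\<integral>y. indicator A x * c * f y \<partial>U \<alpha> x)"
        by (intro integral_cong_AE) auto
      then show ?case by simp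
    qed
  qed
  ultimately show ?thesis
    unfolding invariant_function_def by (auto intro!: bexI[of _ \<infinity>])
qed

section \<open>Conditioning \<open>m\<close> on an invariant set\<close>

text \<open>Invariance of a function means that it can be pulled out of the kernels, which the
  constant 1 satisfies even where mass is lost. Hence \<open>m\<close> belongs to this set although
  it need not be an invariant measure.\<close>

lemma invariant_density_measures_self: "m \<in> invariant_density_measures U m"
proof -
  have "invariant_set (space m)"
    by (auto simp: invariant_set_iff)
  then have "invariant_function U m (\<lambda>x. indicator (space m) x * 1)"
    by (rule invariant_function_indicator)
  moreover have "density m (\<lambda>x. ennreal (indicator (space m) x * 1)) = density m (\<lambda>_. 1)"
    by (intro density_cong) auto
  then have "density m (\<lambda>x. ennreal (indicator (space m) x * 1)) = m"
    by (simp add: density_1)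
  ultimately show ?thesis
    unfolding invariant_density_measures_def using prob_space_axioms by (auto intro!: exI[of _ "\<lambda>x. indicator (space m) x * 1"])
qed

lemma uniform_measure_in_invariant_density_measures:
  assumes A: "invariant_set A" "measure m A > 0"
  shows "uniform_measure m A \<in> invariant_density_measures U m"
proof -
  have [measurable]: "A \<in> sets m" using A by (simp add: invariant_set_sets)
  let ?u = "\<lambda>x. indicator A x * (1 / measure m A)"
  have "density m (\<lambda>x. ennreal (?u x)) = uniform_measure m A"
    unfolding uniform_measure_def using A(2)
    by (intro density_cong) (auto simp: emeasure_eq_measure divide_ennreal split: split_indicator simp flip: ennreal_1)
  moreover have "prob_space (uniform_measure m A)"
    using A(2) by (intro prob_space_uniform_measure) (auto simp: emeasure_eq_measure)
  ultimately show ?thesis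
    unfolding invariant_density_measures_def
    using invariant_function_indicator[OF A(1), of "1 / measure m A"]
    by (auto intro!: exI[of _ ?u])
qed

text \<open>Almost everywhere, mass neither leaves nor enters \<open>A\<close>, so
  \<open>U \<alpha> x B\<close> restricted to starting points in \<open>A\<close> equals
  \<open>U \<alpha> x (A \<inter> B)\<close>. Invariance of \<open>m\<close> is then applied to
  \<open>A \<inter> B\<close>.\<close>

lemma uniform_measure_in_invariant_prob_measures:
  assumes A: "invariant_set A" "measure m A > 0" and m: "m \<in> invariant_prob_measures E U"
  shows "uniform_measure m A \<in> invariant_prob_measures E U"
proof -
  have A_sets [measurable]: "A \<in> sets m" using A by (simp add: invariant_set_sets)
  have "(\<integral>\<^sup>+x. ennreal \<alpha> * emeasure (U \<alpha> x) B \<partial>uniform_measure m A) = emeasure (uniform_measure m A) B"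
    if "\<alpha> > 0" and B: "B \<in> sets m" for \<alpha> B
  proof -
    have [measurable]: "B \<in> sets m" by fact
    have "AE x in m. (x \<in> A \<longrightarrow> measure (U \<alpha> x) (space m - A) = 0) \<and> (x \<notin> A \<longrightarrow> measure (U \<alpha> x) A = 0)"
      using A \<open>\<alpha> > 0\<close> by (auto simp: invariant_set_iff)
    then have "AE x in m. emeasure (U \<alpha> x) B * indicator A x = emeasure (U \<alpha> x) (A \<inter> B)"
      using AE_space
    proof eventually_elim
      case (elim x)
      have [measurable]: "A \<in> sets (U \<alpha> x)" "B \<in> sets (U \<alpha> x)" "space m - A \<in> sets (U \<alpha> x)"
        using elim(2) \<open>\<alpha> > 0\<close> by (auto simp: sets_U)
      show ?case
      proof (cases "x \<in> A")
        case True
        then have "space m - A \<in> null_sets (U \<alpha> x)"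
          using elim \<open>\<alpha> > 0\<close> by (auto simp: emeasure_U sets_U)
        then have "emeasure (U \<alpha> x) (B - (space m - A)) = emeasure (U \<alpha> x) B"
          by (rule emeasure_Diff_null_set) simp
        moreover have "B - (space m - A) = A \<inter> B"
          using sets.sets_into_space[OF B] by auto
        ultimately show ?thesis using True by simp
      next
        case False
        then have "A \<in> null_sets (U \<alpha> x)"
          using elim \<open>\<alpha> > 0\<close> by (auto simp: emeasure_U sets_U)
        then have "emeasure (U \<alpha> x) (A \<inter> B) = 0"
          using emeasure_eq_0[of A "U \<alpha> x" "A \<inter> B"] by (auto simp: null_sets_def)
        then show ?thesis using False by simp
      qed
    qed
    then have "(\<integral>\<^sup>+x. ennreal \<alpha> * emeasure (U \<alpha> x) B * indicator A x \<partial>m) =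
        (\<integral>\<^sup>+x. ennreal \<alpha> * emeasure (U \<alpha> x) (A \<inter> B) \<partial>m)"
      by (intro nn_integral_cong_AE) (auto simp: mult.assoc)
    also have "\<dots> = emeasure m (A \<inter> B)"
      using m \<open>\<alpha> > 0\<close> B A_sets by (auto simp: invariant_prob_measures_def sets_m)
    finally show ?thesis
      using \<open>\<alpha> > 0\<close> by (simp add: nn_integral_uniform_measure)
  qed
  moreover have "prob_space (uniform_measure m A)"
    using A(2) by (intro prob_space_uniform_measure) (auto simp: emeasure_eq_measure)
  ultimately show ?thesis
    by (auto simp: invariant_prob_measures_def sets_m)
qed

section \<open>Extremality and triviality of invariant sets\<close>

text \<open>\<open>m\<close> is the mixture of its conditionings on \<open>A\<close> and on the
  complement, with weights \<open>measure m A\<close> and \<open>1 - measure m A\<close>.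
  Extremality would identify \<open>m\<close> with a measure that does not charge the complement.
  The class \<open>C\<close> is a parameter because the argument serves both (iii) and (iv).\<close>

lemma extremal_imp_invariant_set_trivial:
  assumes ext: "extremal_in m C"
    and C: "\<And>A. invariant_set A \<Longrightarrow> measure m A > 0 \<Longrightarrow> uniform_measure m A \<in> C"
    and A: "invariant_set A"
  shows "measure m A = 0 \<or> measure m (space m - A) = 0"
proof (rule ccontr)
  assume contr: "\<not> ?thesis"
  have [measurable]: "A \<in> sets m" using A by (rule invariant_set_sets)
  let ?A' = "space m - A"
  have pos: "measure m A > 0" "measure m ?A' > 0"
    using contr by (auto simp: zero_less_measure_iff)
  have compl: "measure m ?A' = 1 - measure m A"
    by (simp add: prob_compl)
  have "measure m B = measure m A * measure (uniform_measure m A) B +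
      (1 - measure m A) * measure (uniform_measure m ?A') B" if [measurable]: "B \<in> sets m" for B
  proof -
    have "measure m A * measure (uniform_measure m A) B = measure m (A \<inter> B)"
      "measure m ?A' * measure (uniform_measure m ?A') B = measure m (?A' \<inter> B)"
      using pos by (simp_all add: measure_uniform_measure emeasure_eq_measure)
    moreover have "measure m B = measure m (A \<inter> B) + measure m (?A' \<inter> B)"
      using sets.sets_into_space[OF that]
      by (subst finite_measure_Union[symmetric]) (auto intro!: arg_cong[where f="measure m"])
    ultimately show ?thesis using compl by simp
  qed
  then have "\<forall>B\<in>sets m. measure m B = measure m A * measure (uniform_measure m A) B +
      (1 - measure m A) * measure (uniform_measure m ?A') B" by blast
  moreover have "measure m A < 1" using pos compl by simp
  ultimately have "uniform_measure m A = m"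
    using ext C[OF A pos(1)] C[OF invariant_set_Compl[OF A] pos(2)] pos(1)
    unfolding extremal_in_def by blast
  then have "measure m ?A' = measure (uniform_measure m A) ?A'"
    by simp
  also have "\<dots> = 0"
    using pos by (simp add: measure_uniform_measure emeasure_eq_measure)
  finally show False using pos by simp
qed

text \<open>Since \<open>m\<close> has mass 1, \<open>u - 1\<close> has integral zero; a function of
  constant sign with integral zero vanishes almost everywhere.\<close>

lemma AE_eq_1I:
  fixes u :: "'a \<Rightarrow> real"
  assumes u: "integrable m u" "(\<integral>x. u x \<partial>m) = 1"
    and "measure m {x \<in> space m. u x > 1} = 0 \<or> measure m {x \<in> space m. u x \<le> 1} = 0"
  shows "AE x in m. u x = 1"
proof -
  have [measurable]: "u \<in> borel_measurable m" using u by auto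
  have 0: "(\<integral>x. u x - 1 \<partial>m) = 0" "(\<integral>x. 1 - u x \<partial>m) = 0"
    using u by (simp_all add: prob_space)
  from assms(3) show ?thesis
  proof
    assume "measure m {x \<in> space m. u x > 1} = 0"
    then have "AE x in m. \<not> u x > 1"
      by (subst AE_iff_measurable[OF _ refl]) (auto simp: emeasure_eq_measure not_le)
    then have "AE x in m. 0 \<le> 1 - u x" by auto
    then have "AE x in m. 1 - u x = 0"
      using 0 u integral_nonneg_eq_0_iff_AE[of m "\<lambda>x. 1 - u x"] by simp
    then show ?thesis by auto
  next
    assume "measure m {x \<in> space m. u x \<le> 1} = 0"
    then have "AE x in m. \<not> u x \<le> 1"
      by (subst AE_iff_measurable[OF _ refl]) (auto simp: emeasure_eq_measure not_less)
    then have "AE x in m. 0 \<le> u x - 1" by auto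
    then have "AE x in m. u x - 1 = 0"
      using 0 u integral_nonneg_eq_0_iff_AE[of m "\<lambda>x. u x - 1"] by simp
    then show ?thesis by auto
  qed
qed

lemma prob_density_eq_self:
  fixes u :: "'a \<Rightarrow> real"
  assumes [measurable]: "u \<in> borel_measurable m" and nonneg: "AE x in m. 0 \<le> u x"
    and p: "prob_space (density m (\<lambda>x. ennreal (u x)))"
    and "measure m {x \<in> space m. u x > 1} = 0 \<or> measure m {x \<in> space m. u x \<le> 1} = 0"
  shows "density m (\<lambda>x. ennreal (u x)) = m"
proof -
  have "(\<integral>\<^sup>+x. ennreal (u x) \<partial>m) = 1"
    using prob_space.emeasure_space_1[OF p] by (simp add: emeasure_density nn_integral_set_ennreal cong: nn_integral_cong)
  then have "has_bochner_integral m u 1"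
    using nonneg by (intro has_bochner_integral_nn_integral) auto
  then have "AE x in m. u x = 1"
    using assms(4) by (intro AE_eq_1I) (auto simp: has_bochner_integral_iff)
  then have "density m (\<lambda>x. ennreal (u x)) = density m (\<lambda>_. 1)"
    by (intro density_cong) auto
  then show ?thesis by (simp add: density_1)
qed

lemma invariant_density_measures_eq_iff_invariant_sets_trivial:
  "invariant_density_measures U m = {m} \<longleftrightarrow>
    (\<forall>A. invariant_set A \<longrightarrow> measure m A = 0 \<or> measure m (space m - A) = 0)"
proof
  assume "invariant_density_measures U m = {m}"
  \<comment> \<open>Extremality in a singleton is trivial, which makes the argument for extremal
    points available.\<close>
  then have "extremal_in m (invariant_density_measures U m)"
    by (simp add: extremal_in_def)
  then show "\<forall>A. invariant_set A \<longrightarrow> measure m A = 0 \<or> measure m (space m - A) = 0"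
    using extremal_imp_invariant_set_trivial uniform_measure_in_invariant_density_measures by blast
next
  assume triv: "\<forall>A. invariant_set A \<longrightarrow> measure m A = 0 \<or> measure m (space m - A) = 0"
  have "\<mu> = m" if \<mu>: "\<mu> \<in> invariant_density_measures U m" for \<mu>
  proof -
    obtain u where u: "\<mu> = density m (\<lambda>x. ennreal (u x))" "invariant_function U m u"
        "AE x in m. 0 \<le> u x" "prob_space (density m (\<lambda>x. ennreal (u x)))"
      using \<mu> by (auto simp: invariant_density_measures_def)
    have "measure m {x \<in> space m. u x > 1} = 0 \<or> measure m (space m - {x \<in> space m. u x > 1}) = 0"
      using triv invariant_function_level_set[OF u(2)] by blast
    moreover have "space m - {x \<in> space m. u x > 1} = {x \<in> space m. u x \<le> 1}"
      by auto
    moreover have "u \<in> borel_measurable m"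
      using u(2) by (rule borel_measurable_invariant_function)
    ultimately show ?thesis
      using u prob_density_eq_self by simp
  qed
  then show "invariant_density_measures U m = {m}"
    using invariant_density_measures_self by blast
qed

lemma irreducible_imp_invariant_density_measures:
  "irreducible_resolvent U m \<Longrightarrow> invariant_density_measures U m = {m}"
  by (auto simp: irreducible_resolvent_def invariant_density_measures_eq_iff_invariant_sets_trivial
      invariant_set_def emeasure_eq_measure)

lemma invariant_density_measures_eq_iff_extremal:
  "invariant_density_measures U m = {m} \<longleftrightarrow> extremal_in m (invariant_density_measures U m)"
proof
  assume "extremal_in m (invariant_density_measures U m)"
  then show "invariant_density_measures U m = {m}"
    unfolding invariant_density_measures_eq_iff_invariant_sets_trivial
    using extremal_imp_invariant_set_trivial uniform_measure_in_invariant_density_measures by blast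
qed (simp add: extremal_in_def)

lemma irreducible_iff_invariant_density_measures:
  assumes "\<And>A. absorbing U m A \<Longrightarrow> absorbing U m (space m - A)"
  shows "irreducible_resolvent U m \<longleftrightarrow> invariant_density_measures U m = {m}"
  using assms by (auto simp: irreducible_resolvent_def invariant_set_def
      invariant_density_measures_eq_iff_invariant_sets_trivial emeasure_eq_measure)

section \<open>Symmetric resolvents\<close>

text \<open>Symmetry, tested with the indicators of \<open>A\<close> and its complement, equates the
  total flow from \<open>A\<close> to the complement with the flow back; the first is zero by
  absorption.\<close>

lemma symmetric_absorbing_Compl:
  assumes sym: "symmetric_resolvent U m" and A: "absorbing U m A"
  shows "absorbing U m (space m - A)"
proof -
  have [measurable]: "A \<in> sets m" using A by (simp add: absorbing_iff)
  let ?A' = "space m - A"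
  have "AE x in m. x \<in> ?A' \<longrightarrow> measure (U \<alpha> x) A = 0" if "\<alpha> > 0" for \<alpha>
  proof -
    have nn: "(\<integral>\<^sup>+x. indicator S x * (\<integral>\<^sup>+y. indicator T y \<partial>U \<alpha> x) \<partial>m) =
        (\<integral>\<^sup>+x. indicator S x * emeasure (U \<alpha> x) T \<partial>m)" if "T \<in> sets m" for S T
      using \<open>\<alpha> > 0\<close> that by (intro nn_integral_cong) (auto simp: sets_U)
    have "(\<integral>\<^sup>+x. indicator ?A' x * (\<integral>\<^sup>+y. indicator A y \<partial>U \<alpha> x) \<partial>m) =
        (\<integral>\<^sup>+x. indicator A x * (\<integral>\<^sup>+y. indicator ?A' y \<partial>U \<alpha> x) \<partial>m)"
      by (rule sym[unfolded symmetric_resolvent_def, rule_format, OF that]) simp_all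
    then have "(\<integral>\<^sup>+x. indicator ?A' x * emeasure (U \<alpha> x) A \<partial>m) =
        (\<integral>\<^sup>+x. indicator A x * emeasure (U \<alpha> x) ?A' \<partial>m)"
      by (simp add: nn)
    also have "\<dots> = (\<integral>\<^sup>+x. 0 \<partial>m)"
    proof (rule nn_integral_cong_AE)
      have "AE x in m. x \<in> A \<longrightarrow> measure (U \<alpha> x) ?A' = 0"
        using A that by (simp add: absorbing_iff)
      then show "AE x in m. indicator A x * emeasure (U \<alpha> x) ?A' = 0"
        using AE_space by eventually_elim (use that in \<open>auto simp: emeasure_U split: split_indicator\<close>)
    qed
    finally have "AE x in m. indicator ?A' x * emeasure (U \<alpha> x) A = 0"
      using that by (simp add: nn_integral_0_iff_AE)
    then show ?thesis
      by eventually_elim (auto simp: measure_def)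
  qed
  moreover have "space m - ?A' = A"
    using sets.sets_into_space[OF \<open>A \<in> sets m\<close>] by auto
  ultimately show ?thesis by (simp add: absorbing_iff)
qed

section \<open>Recurrent resolvents: loss of mass and absorbing sets\<close>

text \<open>The points where killing occurs. Even under recurrence this set need not be
  \<open>m\<close>-null: for \<open>U = 0\<close> it is the whole space.\<close>

definition defect_set :: "real \<Rightarrow> 'a set" where
  "defect_set \<alpha> = {x \<in> space m. \<alpha> * measure (U \<alpha> x) (space m) < 1}"

lemma sets_defect_set [measurable]: "\<alpha> > 0 \<Longrightarrow> defect_set \<alpha> \<in> sets m"
  unfolding defect_set_def by measurable

text \<open>The resolvent equation applied to 1 rewrites the integral as \<open>U\<^sub>\<alpha> 1 -
  \<beta> U\<^sub>\<beta> U\<^sub>\<alpha> 1\<close>, which is at most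
  \<open>U\<^sub>\<alpha> 1\<close>. The bound is uniform in \<beta> and so survives the supremum
  defining the initial kernel.\<close>

lemma integral_defect_le:
  assumes "\<alpha> > 0" "\<beta> > 0" "x \<in> space m"
  shows "(\<integral>y. 1 - \<alpha> * measure (U \<alpha> y) (space m) \<partial>U \<beta> x) \<le> 1 / \<alpha>"
proof -
  interpret Ux: finite_measure "U \<beta> x" by (rule finite_measure_U[OF assms(2,3)])
  let ?I = "\<integral>y. measure (U \<alpha> y) (space m) \<partial>U \<beta> x"
  have [measurable]: "(\<lambda>y. measure (U \<alpha> y) (space m)) \<in> borel_measurable (U \<beta> x)"
    using assms by (intro measurable_U) auto
  have "integrable (U \<beta> x) (\<lambda>y. measure (U \<alpha> y) (space m))"
    by (rule Ux.integrable_const_bound[where B="1/\<alpha>"])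
      (use assms measure_U_le in \<open>auto simp: space_U field_simps intro!: AE_I2\<close>)
  then have "(\<integral>y. 1 - \<alpha> * measure (U \<alpha> y) (space m) \<partial>U \<beta> x) = measure (U \<beta> x) (space m) - \<alpha> * ?I"
    using assms by (simp add: space_U)
  also have "\<dots> = measure (U \<alpha> x) (space m) - \<beta> * ?I"
    using resolvent_equation[OF assms(2,1,3), of "space m"] by (simp add: algebra_simps)
  also have "\<dots> \<le> 1 / \<alpha>"
  proof -
    have "\<beta> * ?I \<ge> 0" using assms by (simp add: integral_nonneg_AE)
    moreover have "measure (U \<alpha> x) (space m) \<le> 1 / \<alpha>"
      using measure_U_le[OF assms(1,3), of "space m"] assms(1) by (simp add: field_simps)
    ultimately show ?thesis by linarith
  qed
  finally show ?thesis .
qed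

text \<open>
  The resolvent equation bounds the potential of \<open>1 - \<alpha>U\<^sub>\<alpha>1\<close> by \<open>1/\<alpha>\<close>, so by recurrence it vanishes.
\<close>

lemma recurrent_defect_set:
  assumes rec: "recurrent_resolvent U m" and \<alpha>: "\<alpha> > 0" and \<beta>: "\<beta> > 0"
  shows "AE x in m. measure (U \<beta> x) (defect_set \<alpha>) = 0"
proof -
  \<comment> \<open>Chebyshev's inequality: the indicator of \<open>D k\<close> is at most
    \<open>Suc k\<close> times the defect, so its potential is finite everywhere, which leaves
    recurrence only the value 0. The sets \<open>D k\<close> exhaust the defect set.\<close>
  define D where "D k = {x \<in> space m. 1 / real (Suc k) \<le> 1 - \<alpha> * measure (U \<alpha> x) (space m)}" for k
  have D_sets [measurable]: "D k \<in> sets m" for k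
    unfolding D_def using \<alpha> by measurable
  have "AE x in m. measure (U \<beta> x) (D k) = 0" for k
  proof -
    let ?u = "initial_kernel U (indicator (D k))"
    have fin: "?u x < \<infinity>" if x: "x \<in> space m" for x
    proof -
      have "measure (U \<gamma> x) (D k) \<le> real (Suc k) / \<alpha>" if \<gamma>: "\<gamma> > 0" for \<gamma>
      proof -
        interpret Ux: finite_measure "U \<gamma> x" by (rule finite_measure_U[OF \<gamma> x])
        have [measurable]: "(\<lambda>y. measure (U \<alpha> y) (space m)) \<in> borel_measurable (U \<gamma> x)"
            "D k \<in> sets (U \<gamma> x)"
          using \<alpha> \<gamma> x by (auto simp: sets_U intro: measurable_U)
        have int: "integrable (U \<gamma> x) (\<lambda>y. 1 - \<alpha> * measure (U \<alpha> y) (space m))"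
          by (rule Ux.integrable_const_bound[where B=1])
            (use \<alpha> \<gamma> x measure_U_le in \<open>auto simp: space_U intro!: AE_I2\<close>)
        have "measure (U \<gamma> x) (D k) = (\<integral>y. indicator (D k) y \<partial>U \<gamma> x)"
          by simp
        also have "\<dots> \<le> (\<integral>y. real (Suc k) * (1 - \<alpha> * measure (U \<alpha> y) (space m)) \<partial>U \<gamma> x)"
        proof (rule integral_mono)
          fix y assume "y \<in> space (U \<gamma> x)"
          then have "\<alpha> * measure (U \<alpha> y) (space m) \<le> 1"
            using \<alpha> \<gamma> x by (intro measure_U_le) (auto simp: space_U)
          then show "indicator (D k) y \<le> real (Suc k) * (1 - \<alpha> * measure (U \<alpha> y) (space m))"
            by (auto simp: D_def divide_le_eq mult.commute split: split_indicator simp del: of_nat_Suc)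
        qed (use int in \<open>auto simp: Ux.integrable_const_bound[where B=1] simp del: of_nat_Suc\<close>)
        also have "\<dots> \<le> real (Suc k) * (1 / \<alpha>)"
          using mult_left_mono[OF integral_defect_le[OF \<alpha> \<gamma> x], of "real (Suc k)"] by simp
        finally show ?thesis by simp
      qed
      then have "?u x \<le> ennreal (real (Suc k) / \<alpha>)"
        unfolding initial_kernel_def using x
        by (intro SUP_least) (auto simp: sets_U emeasure_U simp del: of_nat_Suc intro!: ennreal_leI)
      then show ?thesis by (rule le_less_trans) simp
    qed
    have "(\<integral>\<^sup>+x. indicator (D k) x \<partial>m) < \<infinity>"
      by (simp add: emeasure_eq_measure)
    then have "emeasure m {x \<in> space m. 0 < ?u x \<and> ?u x < \<infinity>} = 0"
      by (rule rec[unfolded recurrent_resolvent_def, rule_format, rotated]) simp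
    \<comment> \<open>\<open>emeasure\<close> is 0 by default on non-measurable sets, so the
      conclusion of recurrence yields a null set only after this set is rewritten by countably many
      conditions and shown to be measurable.\<close>
    moreover have "{x \<in> space m. 0 < ?u x \<and> ?u x < \<infinity>} =
        {x \<in> space m. \<not> (\<forall>n. measure (U (1 / real (Suc n)) x) (D k) = 0)}"
      using fin initial_kernel_indicator_eq_0_iff[of _ "D k"]
      by (auto simp: zero_less_iff_neq_zero simp del: of_nat_Suc)
    moreover have [measurable]: "(\<lambda>x. measure (U (1 / real (Suc n)) x) (D k)) \<in> borel_measurable m" for n
      by (rule borel_measurable_measure_U) auto
    have "{x \<in> space m. \<not> (\<forall>n. measure (U (1 / real (Suc n)) x) (D k) = 0)} \<in> sets m"
      by measurable
    ultimately have "AE x in m. True \<longrightarrow> (\<forall>n. measure (U (1 / real (Suc n)) x) (D k) = 0)"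
      by (subst AE_iff_null) (auto simp: null_sets_def)
    then have "AE x in m. True \<longrightarrow> ?u x = 0"
      using AE_space by eventually_elim (simp add: initial_kernel_indicator_eq_0_iff del: of_nat_Suc)
    then show ?thesis
      using \<beta> by (subst (asm) AE_initial_kernel_indicator_eq_0_iff) auto
  qed
  then have "AE x in m. \<forall>k. measure (U \<beta> x) (D k) = 0"
    by (simp add: AE_all_countable)
  then show ?thesis
    using AE_space
  proof eventually_elim
    case (elim x)
    have "(\<Union>k. D k) \<in> null_sets (U \<beta> x)"
      using elim \<beta> by (intro null_sets_UN) (auto simp: emeasure_U sets_U)
    moreover have "(\<Union>k. D k) = defect_set \<alpha>"
    proof (intro equalityI subsetI)
      fix y assume y: "y \<in> defect_set \<alpha>"
      then obtain k where "inverse (real (Suc k)) < 1 - \<alpha> * measure (U \<alpha> y) (space m)"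
        using reals_Archimedean[of "1 - \<alpha> * measure (U \<alpha> y) (space m)"] by (auto simp: defect_set_def)
      then show "y \<in> (\<Union>k. D k)"
        using y by (auto simp: D_def defect_set_def inverse_eq_divide intro!: exI[of _ k])
    next
      fix y assume "y \<in> (\<Union>k. D k)"
      then obtain k where "y \<in> space m" "1 / real (Suc k) \<le> 1 - \<alpha> * measure (U \<alpha> y) (space m)"
        by (auto simp: D_def)
      moreover have "1 / real (Suc k) > 0" by simp
      ultimately have "y \<in> space m" "\<alpha> * measure (U \<alpha> y) (space m) < 1" by linarith+
      then show "y \<in> defect_set \<alpha>"
        by (simp add: defect_set_def)
    qed
    ultimately show ?case
      by (auto simp: null_sets_def measure_def)
  qed
qed

lemma measure_U_Diff:
  assumes "\<alpha> > 0" "x \<in> space m" "A \<in> sets m"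
  shows "measure (U \<alpha> x) (space m - A) = measure (U \<alpha> x) (space m) - measure (U \<alpha> x) A"
  using finite_measure.finite_measure_compl[OF finite_measure_U[OF assms(1,2)], of A] assms
  by (simp add: space_U sets_U)

text \<open>
  By recurrence \<open>\<alpha>U\<^sub>\<alpha>\<close> has total mass 1 on the part \<open>C\<close> of \<open>A\<close> outside the defect set and cannot
  leave \<open>C\<close>; sub-invariance then leaves no mass to enter \<open>C\<close> from its complement.
\<close>

lemma recurrent_absorbing_Compl:
  assumes rec: "recurrent_resolvent U m" and A: "absorbing U m A"
  shows "absorbing U m (space m - A)"
proof -
  have A_sets [measurable]: "A \<in> sets m" using A by (simp add: absorbing_iff)
  have "AE x in m. x \<in> space m - A \<longrightarrow> measure (U \<alpha> x) A = 0" if \<alpha>: "\<alpha> > 0" for \<alpha>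
  proof -
    let ?B = "defect_set \<alpha>"
    \<comment> \<open>At defect points of \<open>A\<close> the mass
      \<open>\<alpha> * measure (U \<alpha> x) A\<close> is below 1, so it need not dominate the
      indicator of \<open>A\<close>. Removing them gives this domination for \<open>C\<close>, and
      by \<open>eq\<close> almost every kernel gives \<open>A\<close> and \<open>C\<close> the same
      mass.\<close>
    define C where "C = A - ?B"
    have B_sets [measurable]: "?B \<in> sets m" using \<alpha> by (rule sets_defect_set)
    have C_sets [measurable]: "C \<in> sets m" by (simp add: C_def)
    have eq: "AE x in m. measure (U \<alpha> x) C = measure (U \<alpha> x) A"
      using recurrent_defect_set[OF rec \<alpha> \<alpha>] AE_space
    proof eventually_elim
      case (elim x)
      then have "?B \<in> null_sets (U \<alpha> x)"
        using \<alpha> by (auto simp: emeasure_U sets_U)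
      then show ?case
        using elim(2) \<alpha> A_sets by (simp add: C_def measure_Diff_null_set sets_U)
    qed
    have "AE x in m. x \<in> A \<longrightarrow> measure (U \<alpha> x) (space m - A) = 0"
      using A \<alpha> by (simp add: absorbing_iff)
    then have one: "AE x in m. x \<in> C \<longrightarrow> \<alpha> * measure (U \<alpha> x) C = 1"
      using eq AE_space
    proof eventually_elim
      case (elim x)
      then show ?case
        using measure_U_Diff[OF \<alpha> elim(3) A_sets] measure_U_le[OF \<alpha> elim(3), of "space m"]
        by (auto simp: C_def defect_set_def)
    qed
    have int: "integrable m (\<lambda>x. \<alpha> * measure (U \<alpha> x) C)" "integrable m (indicator C :: _ \<Rightarrow> real)"
      using \<alpha> by (auto simp: integrable_measure_U emeasure_eq_measure)
    have "(\<integral>x. \<alpha> * measure (U \<alpha> x) C - indicator C x \<partial>m) \<le> 0"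
      using sub_invariant_integral_le[OF \<alpha> C_sets] int by simp
    moreover have nonneg: "AE x in m. 0 \<le> \<alpha> * measure (U \<alpha> x) C - indicator C x"
      using one by eventually_elim (use \<alpha> in \<open>auto split: split_indicator\<close>)
    ultimately have "(\<integral>x. \<alpha> * measure (U \<alpha> x) C - indicator C x \<partial>m) = 0"
      using integral_nonneg_AE[OF nonneg] by simp
    then have "AE x in m. \<alpha> * measure (U \<alpha> x) C - indicator C x = 0"
      using nonneg int by (subst (asm) integral_nonneg_eq_0_iff_AE) auto
    then show ?thesis
      using eq by eventually_elim (use \<alpha> in \<open>auto simp: C_def\<close>)
  qed
  moreover have "space m - (space m - A) = A"
    using sets.sets_into_space[OF A_sets] by auto
  ultimately show ?thesis by (simp add: absorbing_iff)
qed

section \<open>Invariance of \<open>m\<close>\<close>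

text \<open>Almost no kernel charges the defect set, so its complement is absorbing and one of the
  two is \<open>m\<close>-null. Were it the complement, the kernels would not charge it either,
  because sub-invariance preserves null sets; then \<open>U = 0\<close> almost everywhere.\<close>

lemma recurrent_irreducible_AE_markov:
  assumes rec: "recurrent_resolvent U m" and irr: "irreducible_resolvent U m"
    and nz: "nonzero_resolvent U m" and \<alpha>: "\<alpha> > 0"
  shows "AE x in m. \<alpha> * measure (U \<alpha> x) (space m) = 1"
proof -
  let ?B = "defect_set \<alpha>"
  have B_sets [measurable]: "?B \<in> sets m" using \<alpha> by (rule sets_defect_set)
  have diff: "space m - (space m - ?B) = ?B"
    by (auto simp: defect_set_def)
  have null: "AE x in m. measure (U \<beta> x) ?B = 0" if "\<beta> > 0" for \<beta>
    using recurrent_defect_set[OF rec \<alpha> that] .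
  have "AE x in m. x \<in> space m - ?B \<longrightarrow> measure (U \<beta> x) ?B = 0" if "\<beta> > 0" for \<beta>
    using null[OF that] by eventually_elim simp
  then have "absorbing U m (space m - ?B)"
    by (simp add: absorbing_iff diff)
  then have "measure m (space m - ?B) = 0 \<or> measure m ?B = 0"
    using irr diff by (auto simp: irreducible_resolvent_def emeasure_eq_measure)
  moreover have "measure m (space m - ?B) \<noteq> 0"
  proof
    assume *: "measure m (space m - ?B) = 0"
    have "AE x in m. True \<longrightarrow> measure (U \<beta> x) (space m) = 0" if "\<beta> > 0" for \<beta>
      using AE_U_null[OF that _ *, simplified] null[OF that] AE_space
      by eventually_elim (use that measure_U_Diff in simp)
    then have "AE x in m. True \<longrightarrow> initial_kernel U (indicator (space m)) x = 0"
      by (subst AE_initial_kernel_indicator_eq_0_iff) auto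
    then have "AE x in m. initial_kernel U (\<lambda>_. 1) x = 0"
      using AE_space
    proof eventually_elim
      case (elim x)
      have "initial_kernel U (\<lambda>_. 1) x = initial_kernel U (indicator (space m)) x"
        unfolding initial_kernel_def using elim(2)
        by (intro SUP_cong refl nn_integral_cong) (auto simp: space_U)
      then show ?case using elim by simp
    qed
    then show False using nz by (simp add: nonzero_resolvent_def)
  qed
  ultimately have "AE x in m. x \<notin> ?B"
    by (intro AE_not_in) (auto simp: emeasure_eq_measure)
  then show ?thesis
    using AE_space
  proof eventually_elim
    case (elim x)
    then show ?case
      using measure_U_le[OF \<alpha> elim(2), of "space m"] by (auto simp: defect_set_def)
  qed
qed

text \<open>Sub-invariance gives an inequality for \<open>A\<close> and one for its complement. When
  no mass is lost both sides add up to 1, so neither inequality can be strict.\<close>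

lemma AE_markov_imp_invariant:
  assumes markov: "\<And>\<alpha>. \<alpha> > 0 \<Longrightarrow> AE x in m. \<alpha> * measure (U \<alpha> x) (space m) = 1"
  shows "m \<in> invariant_prob_measures E U"
proof -
  have "(\<integral>\<^sup>+x. ennreal \<alpha> * emeasure (U \<alpha> x) A \<partial>m) = emeasure m A" if \<alpha>: "\<alpha> > 0" and A: "A \<in> sets m" for \<alpha> A
  proof -
    let ?V = "\<lambda>A. \<integral>x. \<alpha> * measure (U \<alpha> x) A \<partial>m"
    have "?V A + ?V (space m - A) = (\<integral>x. \<alpha> * measure (U \<alpha> x) A + \<alpha> * measure (U \<alpha> x) (space m - A) \<partial>m)"
      using \<alpha> A by (intro Bochner_Integration.integral_add[symmetric]) (auto simp: integrable_measure_U)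
    also have "\<dots> = (\<integral>x. 1 \<partial>m)"
    proof (rule integral_cong_AE)
      show "AE x in m. \<alpha> * measure (U \<alpha> x) A + \<alpha> * measure (U \<alpha> x) (space m - A) = 1"
        using markov[OF \<alpha>] AE_space
        by eventually_elim (use \<alpha> A measure_U_Diff in \<open>simp add: right_diff_distrib\<close>)
    qed (use \<alpha> A in auto)
    finally have "?V A = measure m A"
      using sub_invariant_integral_le[OF \<alpha> A] sub_invariant_integral_le[OF \<alpha>, of "space m - A"] A
      by (simp add: prob_space prob_compl)
    then have "ennreal (measure m A) = (\<integral>\<^sup>+x. ennreal (\<alpha> * measure (U \<alpha> x) A) \<partial>m)"
      using \<alpha> A by (subst nn_integral_eq_integral) (auto simp: integrable_measure_U)
    also have "\<dots> = (\<integral>\<^sup>+x. ennreal \<alpha> * emeasure (U \<alpha> x) A \<partial>m)"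
      using \<alpha> by (intro nn_integral_cong) (auto simp: emeasure_U ennreal_mult)
    finally show ?thesis by (simp add: emeasure_eq_measure)
  qed
  then show ?thesis
    using prob_space_axioms by (auto simp: invariant_prob_measures_def sets_m)
qed

section \<open>Extremality among the invariant probability measures\<close>

lemma invariant_prob_measures_integral:
  assumes \<mu>: "\<mu> \<in> invariant_prob_measures E U" and \<alpha>: "\<alpha> > 0" and A: "A \<in> sets m"
  shows "(\<integral>x. \<alpha> * measure (U \<alpha> x) A \<partial>\<mu>) = measure \<mu> A"
proof -
  have sets_\<mu>: "sets \<mu> = sets m" and space_\<mu>: "space \<mu> = space m"
    using \<mu> by (auto simp: invariant_prob_measures_def sets_m space_m dest: sets_eq_imp_space_eq)
  interpret \<mu>: prob_space \<mu> using \<mu> by (simp add: invariant_prob_measures_def)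
  have [measurable]: "(\<lambda>x. measure (U \<alpha> x) A) \<in> borel_measurable \<mu>"
    using measurable_cong_sets[OF sets_\<mu> refl] borel_measurable_measure_U[OF \<alpha> A] by blast
  have "(\<integral>\<^sup>+x. ennreal (\<alpha> * measure (U \<alpha> x) A) \<partial>\<mu>) = (\<integral>\<^sup>+x. ennreal \<alpha> * emeasure (U \<alpha> x) A \<partial>\<mu>)"
    using \<alpha> by (intro nn_integral_cong) (auto simp: emeasure_U space_\<mu> ennreal_mult)
  also have "\<dots> = ennreal (measure \<mu> A)"
    using \<mu> \<alpha> A by (simp add: invariant_prob_measures_def sets_m \<mu>.emeasure_eq_measure)
  finally show ?thesis
    using \<alpha> by (intro integral_eq_nn_integral[THEN trans]) auto
qed

text \<open>
  For two invariant measures \<open>m\<close> and \<open>\<mu> = u m\<close>, the set \<open>A = {u > 1}\<close> is absorbing because the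
  integral over \<open>m\<close> of the nonnegative function \<open>(u - 1) (1\<^sub>A - \<alpha>U\<^sub>\<alpha>1\<^sub>A)\<close> is zero.
\<close>

lemma irreducible_absolutely_continuous_invariant_eq:
  assumes irr: "irreducible_resolvent U m" and m: "m \<in> invariant_prob_measures E U"
    and \<mu>: "\<mu> \<in> invariant_prob_measures E U" and ac: "absolutely_continuous m \<mu>"
  shows "\<mu> = m"
proof -
  have sets_\<mu>: "sets \<mu> = sets m"
    using \<mu> by (simp add: invariant_prob_measures_def sets_m)
  interpret \<mu>: prob_space \<mu> using \<mu> by (simp add: invariant_prob_measures_def)
  obtain u where u [measurable]: "u \<in> borel_measurable m" and u_ac: "AE x in m. RN_deriv m \<mu> x = ennreal (u x)"
    and u_nonneg: "\<And>x. 0 \<le> u x"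
    using real_RN_deriv[OF \<mu>.finite_measure_axioms ac sets_\<mu>] by metis
  have dens: "\<mu> = density m (\<lambda>x. ennreal (u x))"
  proof -
    have "density m (RN_deriv m \<mu>) = density m (\<lambda>x. ennreal (u x))"
      using u_ac by (intro density_cong) auto
    then show ?thesis using density_RN_deriv[OF ac sets_\<mu>] by simp
  qed
  have int_u: "integrable m u"
  proof (rule integrableI_nn_integral_finite[where x=1])
    show "(\<integral>\<^sup>+x. ennreal (u x) \<partial>m) = ennreal 1"
      using \<mu>.emeasure_space_1 unfolding dens by (simp add: emeasure_density cong: nn_integral_cong)
  qed (use u_nonneg in auto)
  define A where "A = {x \<in> space m. u x > 1}"
  have A_sets [measurable]: "A \<in> sets m" by (simp add: A_def)
  have "AE x in m. x \<in> A \<longrightarrow> measure (U \<alpha> x) (space m - A) = 0" if \<alpha>: "\<alpha> > 0" for \<alpha>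
  proof -
    let ?V = "\<lambda>x. \<alpha> * measure (U \<alpha> x) A"
    have V: "0 \<le> ?V x" "?V x \<le> 1" if "x \<in> space m" for x
      using \<alpha> measure_U_le[OF \<alpha> that] by auto
    have [measurable]: "?V \<in> borel_measurable m"
      using \<alpha> by measurable
    have intV: "integrable m ?V" using \<alpha> by (simp add: integrable_measure_U)
    have int_uV: "integrable m (\<lambda>x. u x * ?V x)"
      by (rule Bochner_Integration.integrable_bound[OF int_u])
        (use \<alpha> V u_nonneg in \<open>auto simp: abs_mult intro!: AE_I2 mult_left_le\<close>)
    have int_uA: "integrable m (\<lambda>x. u x * indicator A x)"
      using int_u by (intro integrable_real_mult_indicator) auto
    have "(\<integral>x. u x * ?V x \<partial>m) = (\<integral>x. ?V x \<partial>\<mu>)"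
      unfolding dens using u_nonneg by (subst integral_density) auto
    also have "\<dots> = (\<integral>x. indicator A x \<partial>\<mu>)"
      using invariant_prob_measures_integral[OF \<mu> \<alpha> A_sets] A_sets sets_\<mu> by simp
    also have "\<dots> = (\<integral>x. u x * indicator A x \<partial>m)"
      unfolding dens using u_nonneg by (subst integral_density) auto
    finally have 1: "(\<integral>x. u x * ?V x \<partial>m) = (\<integral>x. u x * indicator A x \<partial>m)" .
    have 2: "(\<integral>x. ?V x \<partial>m) = (\<integral>x. indicator A x \<partial>m)"
      using invariant_prob_measures_integral[OF m \<alpha> A_sets] by simp
    let ?g = "\<lambda>x. (u x * indicator A x - u x * ?V x) - (indicator A x - ?V x)"
    have iA: "integrable m (indicator A :: _ \<Rightarrow> real)"
      by (simp add: emeasure_eq_measure)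
    have int_g: "integrable m ?g"
      by (intro Bochner_Integration.integrable_diff int_uA int_uV iA intV)
    have "(\<integral>x. ?g x \<partial>m) = 0"
      using 1 2 int_uA int_uV iA intV by (subst Bochner_Integration.integral_diff, simp, simp) (subst (1 2) Bochner_Integration.integral_diff; simp)
    moreover have g_eq: "?g x = (u x - 1) * (indicator A x - ?V x)" for x
      by (simp add: algebra_simps)
    \<comment> \<open>The factors agree in sign: on \<open>A\<close>, \<open>u > 1\<close> and
      \<open>?V \<le> 1\<close>; off \<open>A\<close>, \<open>u \<le> 1\<close> and the second
      factor is \<open>- ?V\<close>.\<close>
    have "0 \<le> ?g x" if "x \<in> space m" for x
      unfolding g_eq using V[OF that] that by (auto simp: A_def zero_le_mult_iff mult_le_0_iff split: split_indicator)
    then have "AE x in m. 0 \<le> ?g x" by (rule AE_I2)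
    ultimately have "AE x in m. ?g x = 0"
      using integral_nonneg_eq_0_iff_AE[OF int_g] by blast
    then show ?thesis
      using AE_space
    proof eventually_elim
      case (elim x)
      show ?case
      proof
        \<comment> \<open>Here \<open>u x - 1\<close> is strictly positive, so the other factor is
          zero: \<open>A\<close> already receives the maximal mass 1 and nothing is left for the
          complement.\<close>
        assume "x \<in> A"
        then have "?V x = 1" using elim(1) unfolding g_eq by (auto simp: A_def)
        then have "\<alpha> * measure (U \<alpha> x) (space m - A) \<le> 0"
          using measure_U_Diff[OF \<alpha> elim(2) A_sets] measure_U_le[OF \<alpha> elim(2), of "space m"]
          by (simp add: right_diff_distrib)
        then show "measure (U \<alpha> x) (space m - A) = 0"
          using \<alpha> by (simp add: mult_le_0_iff measure_le_0_iff)
      qed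
    qed
  qed
  then have "absorbing U m A" by (simp add: absorbing_iff)
  then have "measure m A = 0 \<or> measure m (space m - A) = 0"
    using irr by (auto simp: irreducible_resolvent_def emeasure_eq_measure)
  moreover have "space m - A = {x \<in> space m. u x \<le> 1}" by (auto simp: A_def)
  ultimately show ?thesis
    using prob_density_eq_self[OF u] u_nonneg \<mu>.prob_space_axioms unfolding dens A_def by auto
qed

text \<open>A component of \<open>m\<close> with weight \<open>t\<close> satisfies
  \<open>t m1 \<le> m\<close>, hence is absolutely continuous with respect to \<open>m\<close> and
  equals it by the preceding lemma. The second component is the same case with weight
  \<open>1 - t\<close>.\<close>

lemma irreducible_imp_extremal:
  assumes irr: "irreducible_resolvent U m" and m: "m \<in> invariant_prob_measures E U"
  shows "extremal_in m (invariant_prob_measures E U)"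
proof -
  have eq: "m1 = m"
    if m1: "m1 \<in> invariant_prob_measures E U" and t: "0 < t"
      and le: "\<And>A. A \<in> sets m \<Longrightarrow> t * measure m1 A \<le> measure m A" for m1 and t :: real
  proof (rule irreducible_absolutely_continuous_invariant_eq[OF irr m m1])
    interpret m1: prob_space m1 using m1 by (simp add: invariant_prob_measures_def)
    have "sets m1 = sets m" using m1 by (simp add: invariant_prob_measures_def sets_m)
    moreover have "measure m1 A = 0" if "A \<in> sets m" "measure m A = 0" for A
      using le[OF that(1)] t that(2) by (simp add: mult_le_0_iff measure_le_0_iff)
    ultimately show "absolutely_continuous m m1"
      by (auto simp: absolutely_continuous_def null_sets_def emeasure_eq_measure m1.emeasure_eq_measure)
  qed
  show ?thesis
    unfolding extremal_in_def
  proof (intro conjI ballI allI impI m)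
    fix m1 m2 :: "'a measure" and t :: real
    assume *: "m1 \<in> invariant_prob_measures E U" "m2 \<in> invariant_prob_measures E U"
      and t: "0 < t \<and> t < 1 \<and> (\<forall>A\<in>sets m. measure m A = t * measure m1 A + (1 - t) * measure m2 A)"
    show "m1 = m" using t by (intro eq[OF *(1), of t]) auto
    show "m2 = m" using t by (intro eq[OF *(2), of "1 - t"]) auto
  qed
qed

lemma extremal_invariant_prob_measures_imp:
  assumes "extremal_in m (invariant_prob_measures E U)"
  shows "invariant_density_measures U m = {m}"
proof -
  have "m \<in> invariant_prob_measures E U" using assms by (simp add: extremal_in_def)
  then show ?thesis
    unfolding invariant_density_measures_eq_iff_invariant_sets_trivial
    using extremal_imp_invariant_set_trivial[OF assms] uniform_measure_in_invariant_prob_measures by blast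
qed

end

theorem theorem4p3:
  fixes E m :: "'a measure"
    and U :: "real \<Rightarrow> 'a \<Rightarrow> 'a measure"
  assumes "lusin_measurable_space E"
    and "sub_markovian_resolvent E U"
    and "prob_space m"
    and "sub_invariant_measure E U m"
  shows
    "(irreducible_resolvent U m \<longrightarrow> invariant_density_measures U m = {m}) \<and>
     (invariant_density_measures U m = {m} \<longleftrightarrow>
        extremal_in m (invariant_density_measures U m)) \<and>
     (symmetric_resolvent U m \<longrightarrow>
        (irreducible_resolvent U m \<longleftrightarrow> invariant_density_measures U m = {m}) \<and>
        (invariant_density_measures U m = {m} \<longleftrightarrow>
           extremal_in m (invariant_density_measures U m))) \<and>
     (recurrent_resolvent U m \<longrightarrow>
        (irreducible_resolvent U m \<longleftrightarrow> invariant_density_measures U m = {m}) \<and>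
        (invariant_density_measures U m = {m} \<longleftrightarrow>
           extremal_in m (invariant_density_measures U m)) \<and>
        (extremal_in m (invariant_prob_measures E U) \<longrightarrow>
           extremal_in m (invariant_density_measures U m)) \<and>
        (nonzero_resolvent U m \<longrightarrow>
           (extremal_in m (invariant_density_measures U m) \<longleftrightarrow>
              extremal_in m (invariant_prob_measures E U))))"
proof -
  interpret sub_invariant_resolvent m E U
    using assms by (simp add: sub_invariant_resolvent_def sub_invariant_resolvent_axioms_def)
  have sym: "irreducible_resolvent U m \<longleftrightarrow> invariant_density_measures U m = {m}"
    if "symmetric_resolvent U m"
    using irreducible_iff_invariant_density_measures symmetric_absorbing_Compl[OF that] by blast
  have rec: "irreducible_resolvent U m \<longleftrightarrow> invariant_density_measures U m = {m}"
    if "recurrent_resolvent U m"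
    using irreducible_iff_invariant_density_measures recurrent_absorbing_Compl[OF that] by blast
  \<comment> \<open>The way from (iii) to (iv) leads through (i), which \<open>rec\<close> recovers
    from (ii).\<close>
  have ext: "extremal_in m (invariant_prob_measures E U)"
    if "recurrent_resolvent U m" "nonzero_resolvent U m" "irreducible_resolvent U m"
    using that by (intro irreducible_imp_extremal AE_markov_imp_invariant recurrent_irreducible_AE_markov)
  show ?thesis
    using irreducible_imp_invariant_density_measures invariant_density_measures_eq_iff_extremal
      sym rec ext extremal_invariant_prob_measures_imp by blast
qed

end
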